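(* Let $f\in\mathcal{HK}$ and for $re^{i\theta}\in D$ define $u_r(\theta):=P[f](re^{i\theta})$. Then: (a) $\|u_r\|\le\|f\|$ for all $0\le r<1$; i.e. $\sup_{0\le r<1}\|u_r\|\le\|f\|$. (b) $\|u_r-f\|\to0$ as $r\to1$. (c) In (b), the decay of $\|u_r-f\|$ to $0$ can be arbitrarily slow: for every decreasing function $A:[0,1)\to(0,1/2)$ with $A(r)\to0$ as $r\to1$ there is $f\in\mathcal{HK}$ such that, with $u_r(\theta)=P[f](re^{i\theta})$, $\|u_r-f\|\ge A(r)$ for all $0\le r<1$.
   Context: $D$ is the open unit disc in $\mathbb{R}^2$. $\mathcal{HK}$ is the set of $2\pi$-periodic functions $f:\mathbb{R}\to\mathbb{R}$ that are Henstock--Kurzweil integrable over a period, equivalently with finite Alexiewicz norm $\|f\|:=\sup_I|\int_I f|$, the supremum being over intervals $I\subset\mathbb{R}$ of length at most $2\pi$ (all integrals of such $f$ are Henstock--Kurzweil integrals). The Poisson kernel is $\Phi_r(\theta)=\frac{1-r^2}{2\pi(1-2r\cos\theta+r^2)}$ and the Poisson integral of $f$ is $P[f](re^{i\theta})=\int_{-\pi}^{\pi}f(\phi)\Phi_r(\phi-\theta)\,d\phi$. The symbol $\|\cdot\|$ without subscript is the Alexiewicz norm. Limits $r\to1$ are from below. *)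

theory Defs
  imports "HOL-Analysis.Analysis"
begin

definition HK :: "(real \<Rightarrow> real) set" where
  "HK = {f. (\<forall>x. f (x + 2 * pi) = f x) \<and> f integrable_on {-pi..pi}}"

text \<open>The endpoints of an interval do not affect the Henstock--Kurzweil integral, so the supremum
  over all intervals of length at most \<open>2\<pi>\<close> is taken over compact ones.\<close>

definition alexiewicz_norm :: "(real \<Rightarrow> real) \<Rightarrow> real" where
  "alexiewicz_norm f = (SUP (a, b) \<in> {(a, b). a \<le> b \<and> b - a \<le> 2 * pi}. \<bar>integral {a..b} f\<bar>)"

definition poisson_kernel :: "real \<Rightarrow> real \<Rightarrow> real" where
  "poisson_kernel r \<theta> = (1 - r\<^sup>2) / (2 * pi * (1 - 2 * r * cos \<theta> + r\<^sup>2))"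

text \<open>The Poisson integral in polar coordinates: \<open>poisson_integral f r \<theta>\<close> is the value at the point
  \<open>r e\<^sup>i\<^sup>\<theta>\<close> of the disc. It depends only on that point, since the kernel is \<open>2\<pi>\<close>-periodic in
  \<open>\<theta>\<close> and constant for \<open>r = 0\<close>.\<close>

definition poisson_integral :: "(real \<Rightarrow> real) \<Rightarrow> real \<Rightarrow> real \<Rightarrow> real" where
  "poisson_integral f r \<theta> = integral {-pi..pi} (\<lambda>\<phi>. f \<phi> * poisson_kernel r (\<phi> - \<theta>))"

text \<open>A real supremum is meaningful only for a set that is bounded above; this is guaranteed on
  \<open>HK\<close>.\<close>

lemma HK_periodic_int:
  assumes "f \<in> HK"
  shows "f (x + 2 * pi * of_int k) = f x"
proof -
  have p: "f (y + 2 * pi) = f y" for y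
    using assms by (simp add: HK_def)
  have n: "f (y + 2 * pi * real m) = f y" for y and m :: nat
  proof (induction m)
    case (Suc m)
    have "f (y + 2 * pi * real (Suc m)) = f ((y + 2 * pi * real m) + 2 * pi)"
      by (simp add: algebra_simps)
    then show ?case using Suc p by simp
  qed simp
  show ?thesis
  proof (cases "k \<ge> 0")
    case True
    then show ?thesis using n[of x "nat k"] by simp
  next
    case False
    then show ?thesis using n[of "x + 2 * pi * of_int k" "nat (- k)"] by simp
  qed
qed

lemma HK_bdd_above:
  assumes "f \<in> HK"
  shows "bdd_above ((\<lambda>(a, b). \<bar>integral {a..b} f\<bar>) ` {(a, b). a \<le> b \<and> b - a \<le> 2 * pi})"
proof -
  have sh: "f \<circ> (+) (2 * pi * of_int k) = f" for k
    using HK_periodic_int[OF assms] by (auto simp: fun_eq_iff add.commute)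
  have i1: "f integrable_on {-pi..pi}"
    using assms by (simp add: HK_def)
  have i2: "f integrable_on {pi..3 * pi}"
    using i1 integrable_on_shift_Icc_real[of f "2 * pi * of_int 1" "-pi" pi] sh[of 1] by simp
  have i3: "f integrable_on {-pi..3 * pi}"
    by (rule Henstock_Kurzweil_Integration.integrable_combine[OF _ _ i1 i2]) (use pi_gt_zero in linarith)+
  define F where "F x = integral {-pi..x} f" for x
  have "continuous_on {-pi..3 * pi} F"
    unfolding F_def by (rule indefinite_integral_continuous_1[OF i3])
  then have "bounded (F ` {-pi..3 * pi})"
    by (intro compact_imp_bounded compact_continuous_image) auto
  then obtain B where B0: "\<forall>x\<in>{-pi..3 * pi}. \<bar>F x\<bar> \<le> B"
    by (auto simp: bounded_iff)
  have B: "\<bar>F x\<bar> \<le> B" if "-pi \<le> x" "x \<le> 3 * pi" for x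
    using B0 that by simp
  have "\<bar>integral {a..b} f\<bar> \<le> 2 * B" if ab: "a \<le> b" "b - a \<le> 2 * pi" for a b
  proof -
    define k where "k = \<lfloor>(a + pi) / (2 * pi)\<rfloor>"
    define c where "c = a - 2 * pi * of_int k"
    define d where "d = b - 2 * pi * of_int k"
    have "of_int k \<le> (a + pi) / (2 * pi)" "(a + pi) / (2 * pi) < of_int k + 1"
      unfolding k_def by linarith+
    then have "-pi \<le> c" "c < pi"
      by (simp_all add: c_def field_simps)
    moreover have "c \<le> d" "d - c \<le> 2 * pi"
      using ab by (simp_all add: c_def d_def)
    ultimately have cd: "-pi \<le> c" "c \<le> d" "d \<le> 3 * pi"
      by linarith+
    have "integral {a..b} f = integral {c..d} f"
      using integral_shift_Icc_real[of c d f "2 * pi * of_int k"] sh[of k]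
      by (simp add: c_def d_def)
    also have "\<dots> = F d - F c"
    proof -
      have "f integrable_on {-pi..d}"
        by (rule integrable_subinterval_real[OF i3]) (use cd in auto)
      from Henstock_Kurzweil_Integration.integral_combine[OF cd(1,2) this] show ?thesis
        by (simp add: F_def)
    qed
    finally show ?thesis
      using B[of c] B[of d] cd by linarith
  qed
  then show ?thesis
    by (intro bdd_aboveI[of _ "2 * B"]) auto
qed

end

theory Submission imports Defs
begin

text \<open>
  Let \<open>G\<close> be the (continuous) primitive of \<open>f\<close>. Integration by parts moves the kernel off the merely
  Henstock--Kurzweil integrable \<open>f\<close>, and shows that the Poisson average
  \<open>V \<theta> = \<integral> G (\<theta> + t) \<Phi>\<^sub>r t dt\<close> of \<open>G\<close> over a period has derivative \<open>u\<^sub>r\<close>. Hence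
  \<open>\<integral>\<^sub>a\<^sup>b u\<^sub>r = \<integral> (G (b + t) - G (a + t)) \<Phi>\<^sub>r t dt\<close>: as \<open>\<Phi>\<^sub>r\<close> is a probability density this is at most
  \<open>\<parallel>f\<parallel>\<close>, and as \<open>\<Phi>\<^sub>r\<close> concentrates at \<open>0\<close> and \<open>G (x + t) - G x\<close> is small uniformly in \<open>x\<close>, it
  approaches \<open>G b - G a\<close> uniformly in \<open>a\<close> and \<open>b\<close>.

  For the slow decay, take \<open>f\<close> nonnegative of total mass at most \<open>2\<close>, with mass at least \<open>2\<^sup>-\<^sup>k\<close> on a very
  short interval \<open>[0, d\<^sub>k]\<close> for every \<open>k\<close>. Since \<open>u\<^sub>r \<le> 1 / (1 - r)\<close>, the function \<open>u\<^sub>r\<close> has mass at most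
  half of that on \<open>[0, d\<^sub>k]\<close> as long as \<open>d\<^sub>k \<le> 2\<^sup>-\<^sup>k\<^sup>-\<^sup>1 (1 - r)\<close>.
\<close>

subsection \<open>Integration by parts for Henstock--Kurzweil integrals\<close>

text \<open>The oriented integral from 0 to \<open>x\<close>: for \<open>x\<close> of either sign
  one of the two intervals is empty or a single point and contributes 0.\<close>

definition primitive :: "(real \<Rightarrow> real) \<Rightarrow> real \<Rightarrow> real" where
  "primitive f x = integral {0..x} f - integral {x..0} f"

definition locally_integrable :: "(real \<Rightarrow> real) \<Rightarrow> bool" where
  "locally_integrable f \<longleftrightarrow> (\<forall>a b. f integrable_on {a..b})"

lemma locally_integrableD: "locally_integrable f \<Longrightarrow> f integrable_on {a..b}"
  by (simp add: locally_integrable_def)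

lemma continuous_imp_locally_integrable:
  "continuous_on UNIV f \<Longrightarrow> locally_integrable f"
  unfolding locally_integrable_def
  by (meson continuous_on_subset integrable_continuous_real top_greatest)

lemma primitive_diff:
  assumes f: "locally_integrable f" and "x \<le> y"
  shows "primitive f y - primitive f x = integral {x..y} f"
proof -
  note c = Henstock_Kurzweil_Integration.integral_combine[OF _ _ locally_integrableD[OF f]]
  consider "0 \<le> x" | "x < 0" "0 < y" | "y \<le> 0" by linarith
  then show ?thesis
  proof cases
    case 1 then show ?thesis using c[of 0 x y] \<open>x \<le> y\<close>
      by (cases "x = 0"; cases "y = 0") (auto simp: primitive_def)
  next
    case 2 then show ?thesis using c[of x 0 y] by (auto simp: primitive_def)
  next
    case 3 then show ?thesis using c[of x y 0] \<open>x \<le> y\<close>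
      by (cases "x = 0"; cases "y = 0") (auto simp: primitive_def)
  qed
qed

lemma continuous_on_primitive:
  assumes f: "locally_integrable f"
  shows "continuous_on S (primitive f)"
proof -
  have "isCont (primitive f) x" for x
  proof -
    have "continuous_on {x-1..x+1} (\<lambda>y. primitive f (x-1) + integral {x-1..y} f)"
      by (intro continuous_intros indefinite_integral_continuous_1 locally_integrableD f)
    then have "continuous_on {x-1..x+1} (primitive f)"
      by (rule continuous_on_eq) (use primitive_diff[OF f] in force)
    then have "continuous_on {x-1<..<x+1} (primitive f)"
      by (rule continuous_on_subset) auto
    then show ?thesis
      by (simp add: continuous_on_eq_continuous_at)
  qed
  then show ?thesis by (simp add: continuous_at_imp_continuous_on)
qed

lemma DERIV_primitive:
  assumes f: "continuous_on UNIV f"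
  shows "(primitive f has_real_derivative f x) (at x)"
proof -
  \<comment> \<open>Moving the base point from 0 to \<open>x-1\<close> puts \<open>x\<close> in the
    interior of the interval and changes the primitive only by a constant.\<close>
  have "((\<lambda>y. integral {x-1..y} f) has_real_derivative f x) (at x within {x-1..x+1})"
    by (intro integral_has_real_derivative continuous_on_subset[OF f]) auto
  then have "((\<lambda>y. integral {x-1..y} f) has_real_derivative f x) (at x within {x-1<..<x+1})"
    by (rule has_field_derivative_subset) auto
  then have "((\<lambda>y. integral {x-1..y} f) has_real_derivative f x) (at x)"
    by (subst (asm) at_within_open) auto
  then have "((\<lambda>y. primitive f (x-1) + integral {x-1..y} f) has_real_derivative f x) (at x)"
    by (auto intro!: derivative_eq_intros)
  moreover have "primitive f (x-1) + integral {x-1..y} f = primitive f y" if "y \<in> {x-1<..<x+1}" for y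
    using primitive_diff[OF continuous_imp_locally_integrable[OF f], of "x-1" y] that by auto
  ultimately show ?thesis
    by (auto intro: has_field_derivative_transform_within_open[of _ _ _ "{x-1<..<x+1}"])
qed

lemma has_integral_FTC:
  fixes F :: "real \<Rightarrow> real"
  assumes "a \<le> b" "\<And>x. (F has_real_derivative F' x) (at x)"
  shows "(F' has_integral (F b - F a)) {a..b}"
  using assms(2)
  by (intro fundamental_theorem_of_calculus assms(1))
    (auto simp flip: has_real_derivative_iff_has_vector_derivative intro: has_field_derivative_at_within)

text \<open>The primitive has derivative \<open>f\<close> only almost everywhere, so the product rule is not available.
  Instead, the difference \<open>D\<close> of the two sides has derivative \<open>0\<close>: by the second mean value
  theorem its increment over \<open>[x, y]\<close> is at most the oscillation of the primitive times \<open>K y - K x\<close>.\<close>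
lemma has_integral_by_parts_mono:
  fixes f K K' :: "real \<Rightarrow> real"
  assumes f: "locally_integrable f"
    and K: "\<And>x. (K has_real_derivative K' x) (at x)" and K': "continuous_on UNIV K'"
    and nonneg: "\<And>x. 0 \<le> K' x" and "a \<le> b"
  shows "((\<lambda>x. f x * K x) has_integral
    primitive f b * K b - primitive f a * K a - integral {a..b} (\<lambda>x. primitive f x * K' x)) {a..b}"
proof -
  define G where "G = primitive f"
  have G: "continuous_on S G" for S
    unfolding G_def by (rule continuous_on_primitive[OF f])
  have G_diff: "integral {x..y} f = G y - G x" if "x \<le> y" for x y
    using primitive_diff[OF f that] by (simp add: G_def)
  have mono: "K x \<le> K y" if "x \<le> y" for x y
    by (rule DERIV_nonneg_imp_nondecreasing[OF that]) (use K nonneg in blast)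
  have smvt: "\<exists>c\<in>{x..y}. ((\<lambda>t. f t * K t) has_integral
      (K x * (G c - G x) + K y * (G y - G c))) {x..y}" if "x \<le> y" for x y
  proof -
    obtain c where c: "c \<in> {x..y}"
      and "((\<lambda>t. K t * f t) has_integral (K x * integral {x..c} f + K y * integral {c..y} f)) {x..y}"
      using second_mean_value_theorem_full[OF locally_integrableD[OF f] \<open>x \<le> y\<close>, of K] mono by blast
    then have "((\<lambda>t. f t * K t) has_integral (K x * (G c - G x) + K y * (G y - G c))) {x..y}"
      by (simp add: G_diff mult.commute)
    with c show ?thesis by blast
  qed
  \<comment> \<open>Integrability of the product is not automatic for a conditionally convergent
    integral; the second mean value theorem supplies it along with the value.\<close>
  have fK: "locally_integrable (\<lambda>t. f t * K t)"
    unfolding locally_integrable_def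
  proof (intro allI)
    show "(\<lambda>t. f t * K t) integrable_on {x..y}" for x y
      using smvt[of x y] by (cases "x \<le> y") (auto simp: integrable_on_def)
  qed
  have GK': "continuous_on S (\<lambda>t. G t * K' t)" for S
    by (intro continuous_intros G continuous_on_subset[OF K']) auto
  define D where "D x = primitive (\<lambda>t. f t * K t) x - G x * K x + primitive (\<lambda>t. G t * K' t) x" for x
  \<comment> \<open>Inserting the mean value formula makes the boundary terms collapse: the
    increment \<open>D y - D x\<close> is the integral of \<open>(G t - G c) * K' t\<close>, and
    \<open>K'\<close> is nonnegative with integral \<open>K y - K x\<close>.\<close>
  have D_bound: "\<bar>D y - D x\<bar> \<le> e * (K y - K x)"
    if "x \<le> y" and e: "\<And>s t. s \<in> {x..y} \<Longrightarrow> t \<in> {x..y} \<Longrightarrow> \<bar>G s - G t\<bar> \<le> e" for x y e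
  proof -
    obtain c where c: "c \<in> {x..y}" and "((\<lambda>t. f t * K t) has_integral
      (K x * (G c - G x) + K y * (G y - G c))) {x..y}" using smvt[OF \<open>x \<le> y\<close>] by blast
    then have "integral {x..y} (\<lambda>t. f t * K t) = K x * (G c - G x) + K y * (G y - G c)"
      by blast
    moreover have K'_int: "(K' has_integral K y - K x) {x..y}"
      by (rule has_integral_FTC[OF \<open>x \<le> y\<close> K])
    have i: "((\<lambda>t. G t * K' t) has_integral integral {x..y} (\<lambda>t. G t * K' t)) {x..y}"
      using GK' integrable_continuous_real integrable_integral by blast
    have "((\<lambda>t. G t * K' t - G c * K' t) has_integral
        integral {x..y} (\<lambda>t. G t * K' t) - G c * (K y - K x)) {x..y}"
      by (intro has_integral_diff i has_integral_mult_right K'_int)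
    moreover have "((\<lambda>t. e * K' t) has_integral e * (K y - K x)) {x..y}"
      by (intro has_integral_mult_right K'_int)
    moreover have "norm (G t * K' t - G c * K' t) \<le> e * K' t" if "t \<in> {x..y}" for t
      using e[OF that c] nonneg[of t]
      by (simp add: mult_right_mono abs_mult flip: left_diff_distrib)
    ultimately have "norm (integral {x..y} (\<lambda>t. G t * K' t) - G c * (K y - K x)) \<le> e * (K y - K x)"
      by (smt (verit) has_integral_integrable_integral Henstock_Kurzweil_Integration.integral_norm_bound_integral)
    moreover have "D y - D x = integral {x..y} (\<lambda>t. f t * K t) - (G y * K y - G x * K x)
        + integral {x..y} (\<lambda>t. G t * K' t)"
      using primitive_diff[OF fK \<open>x \<le> y\<close>]
        primitive_diff[OF continuous_imp_locally_integrable[OF GK'] \<open>x \<le> y\<close>]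
      by (simp add: D_def)
    ultimately show ?thesis
      using \<open>integral {x..y} (\<lambda>t. f t * K t) = _\<close> by (simp add: algebra_simps)
  qed
  have "(D has_real_derivative 0) (at x)" for x
    unfolding has_field_derivative_def has_derivative_at_alt
  proof (intro conjI allI impI)
    show "bounded_linear ((*) (0::real))" by (rule bounded_linear_mult_right)
    fix e :: real assume "0 < e"
    \<comment> \<open>\<open>L\<close> bounds the difference quotients of \<open>K\<close> near
      \<open>x\<close>. Comparing through \<open>G x\<close> bounds the oscillation of
      \<open>G\<close> by \<open>2 * q\<close>, so \<open>q\<close> is chosen to give
      \<open>2 * q * L = e\<close>.\<close>
    define L where "L = \<bar>K' x\<bar> + 1"
    have "L > 0" by (simp add: L_def add_nonneg_pos)
    define q where "q = e / (2 * L)"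
    have "q > 0" using \<open>e > 0\<close> \<open>L > 0\<close> by (simp add: q_def)
    have "\<exists>d>0. \<forall>y. norm (y - x) < d \<longrightarrow> norm (K y - K x - K' x * (y - x)) \<le> 1 * norm (y - x)"
      using K[of x] unfolding has_field_derivative_def has_derivative_at_alt by (metis zero_less_one)
    then obtain d1 where "d1 > 0" and d1: "\<And>y. \<bar>y - x\<bar> < d1 \<Longrightarrow> \<bar>K y - K x - K' x * (y - x)\<bar> \<le> \<bar>y - x\<bar>"
      by auto
    have KL: "\<bar>K y - K x\<bar> \<le> L * \<bar>y - x\<bar>" if "\<bar>y - x\<bar> < d1" for y
    proof -
      have "\<bar>K y - K x\<bar> \<le> \<bar>K y - K x - K' x * (y - x)\<bar> + \<bar>K' x * (y - x)\<bar>" by linarith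
      also have "\<dots> \<le> \<bar>y - x\<bar> + \<bar>K' x\<bar> * \<bar>y - x\<bar>"
        using d1[OF that] by (simp add: abs_mult)
      finally show ?thesis by (simp add: L_def algebra_simps)
    qed
    have "isCont G x" using G[of UNIV] by (simp add: continuous_on_eq_continuous_at)
    then obtain d2 where "d2 > 0" and d2: "\<And>y. \<bar>y - x\<bar> < d2 \<Longrightarrow> \<bar>G y - G x\<bar> < q"
      using \<open>q > 0\<close> unfolding continuous_at_eps_delta dist_real_def
      by metis
    have osc: "\<bar>G s - G t\<bar> \<le> 2 * q" if "\<bar>s - x\<bar> < d2" "\<bar>t - x\<bar> < d2" for s t
      using d2[OF that(1)] d2[OF that(2)] by linarith
    have "norm (D y - D x - 0 * (y - x)) \<le> e * norm (y - x)" if y: "norm (y - x) < min d1 d2" for y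
    proof -
      have "\<bar>D y - D x\<bar> \<le> 2 * q * \<bar>K y - K x\<bar>"
      proof (cases "x \<le> y")
        case True
        then have "\<bar>D y - D x\<bar> \<le> 2 * q * (K y - K x)"
          by (rule D_bound) (use osc y in auto)
        then show ?thesis using mono[OF True] by simp
      next
        case False
        then have "y \<le> x" by simp
        then have "\<bar>D x - D y\<bar> \<le> 2 * q * (K x - K y)"
          by (rule D_bound) (use osc y in auto)
        then show ?thesis using mono[OF \<open>y \<le> x\<close>] by (simp add: abs_minus_commute)
      qed
      also have "\<dots> \<le> 2 * q * (L * \<bar>y - x\<bar>)"
        using KL[of y] y \<open>q > 0\<close> by (intro mult_left_mono) auto
      finally show ?thesis using \<open>L > 0\<close> by (simp add: q_def)
    qed
    then show "\<exists>d>0. \<forall>y. norm (y - x) < d \<longrightarrow> norm (D y - D x - 0 * (y - x)) \<le> e * norm (y - x)"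
      using \<open>d1 > 0\<close> \<open>d2 > 0\<close> by (intro exI[of _ "min d1 d2"]) auto
  qed
  then have "D b = D a" by (intro DERIV_isconst_all allI)
  then have "integral {a..b} (\<lambda>t. f t * K t)
      = G b * K b - G a * K a - integral {a..b} (\<lambda>x. G x * K' x)"
    using primitive_diff[OF fK \<open>a \<le> b\<close>]
        primitive_diff[OF continuous_imp_locally_integrable[OF GK'] \<open>a \<le> b\<close>]
    by (simp add: D_def)
  then show ?thesis
    using locally_integrableD[OF fK] unfolding G_def by (metis has_integral_integrable_integral)
qed

lemma has_integral_by_parts:
  fixes f K K' :: "real \<Rightarrow> real"
  assumes f: "locally_integrable f"
    and K: "\<And>x. (K has_real_derivative K' x) (at x)" and K': "continuous_on UNIV K'"
    and bound: "\<And>x. \<bar>K' x\<bar> \<le> C" and "a \<le> b"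
  shows "((\<lambda>x. f x * K x) has_integral
    primitive f b * K b - primitive f a * K a - integral {a..b} (\<lambda>x. primitive f x * K' x)) {a..b}"
proof -
  have nonneg: "0 \<le> C" "0 \<le> K' x + C" for x
    using bound[of x] by linarith+
  \<comment> \<open>\<open>K\<close> is the difference of the increasing functions \<open>K x + C x\<close> and \<open>C x\<close>.\<close>
  have "((\<lambda>x. f x * (K x + C * x)) has_integral primitive f b * (K b + C * b) - primitive f a * (K a + C * a)
      - integral {a..b} (\<lambda>x. primitive f x * (K' x + C))) {a..b}"
    by (rule has_integral_by_parts_mono[OF f _ _ nonneg(2) \<open>a \<le> b\<close>])
      (auto intro!: derivative_eq_intros continuous_intros K K')
  moreover have "((\<lambda>x. f x * (C * x)) has_integral primitive f b * (C * b) - primitive f a * (C * a)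
      - integral {a..b} (\<lambda>x. primitive f x * C)) {a..b}"
    by (rule has_integral_by_parts_mono[OF f _ _ nonneg(1) \<open>a \<le> b\<close>])
      (auto intro!: derivative_eq_intros continuous_intros)
  ultimately have "((\<lambda>x. f x * (K x + C * x) - f x * (C * x)) has_integral
      (primitive f b * (K b + C * b) - primitive f a * (K a + C * a)
        - integral {a..b} (\<lambda>x. primitive f x * (K' x + C)))
      - (primitive f b * (C * b) - primitive f a * (C * a) - integral {a..b} (\<lambda>x. primitive f x * C))) {a..b}"
    by (rule has_integral_diff)
  moreover have "integral {a..b} (\<lambda>x. primitive f x * (K' x + C))
      = integral {a..b} (\<lambda>x. primitive f x * K' x) + integral {a..b} (\<lambda>x. primitive f x * C)"
    by (subst Henstock_Kurzweil_Integration.integral_add[symmetric])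
      (auto intro!: integrable_continuous_real continuous_intros continuous_on_primitive f
        continuous_on_subset[OF K'] simp: algebra_simps)
  ultimately show ?thesis
    by (simp add: algebra_simps)
qed

subsection \<open>Convolution with a smooth periodic kernel\<close>

lemma HK_periodic: "f \<in> HK \<Longrightarrow> f (x + 2 * pi) = f x"
  by (simp add: HK_def)

lemma HK_locally_integrable:
  assumes "f \<in> HK"
  shows "locally_integrable f"
proof -
  have shift: "f \<circ> (+) (2 * pi * of_int k) = f" for k
    using HK_periodic_int[OF assms] by (auto simp: fun_eq_iff add.commute)
  have base: "f integrable_on {2 * pi * of_int k - pi..2 * pi * of_int k + pi}" for k
    using assms integrable_on_shift_Icc_real[of f "2 * pi * of_int k" "-pi" pi] shift[of k]
    by (simp add: HK_def add.commute)
  \<comment> \<open>Starting from the central period, each induction step glues one translated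
    period onto either end; these intervals exhaust the line.\<close>
  have sym: "f integrable_on {- (2 * pi * real n + pi)..2 * pi * real n + pi}" for n
  proof (induction n)
    case 0
    then show ?case using base[of 0] by simp
  next
    case (Suc n)
    have le: "- (2 * pi * real n + pi) \<le> 2 * pi * real n + pi"
        "2 * pi * real n + pi \<le> 2 * pi * real (Suc n) + pi"
      using mult_nonneg_nonneg[of pi "real n"] by (simp_all add: distrib_left add_nonneg_nonneg del: mult_nonneg_nonneg)
    have "f integrable_on {2 * pi * real n + pi..2 * pi * real (Suc n) + pi}"
      using base[of "int (Suc n)"] by (simp add: algebra_simps)
    with Suc have "f integrable_on {- (2 * pi * real n + pi)..2 * pi * real (Suc n) + pi}"
      by (rule Henstock_Kurzweil_Integration.integrable_combine[OF le])
    moreover have "f integrable_on {- (2 * pi * real (Suc n) + pi)..- (2 * pi * real n + pi)}"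
      using base[of "- int (Suc n)"] by (simp add: algebra_simps)
    moreover have "- (2 * pi * real (Suc n) + pi) \<le> - (2 * pi * real n + pi)"
        "- (2 * pi * real n + pi) \<le> 2 * pi * real (Suc n) + pi"
      using le by linarith+
    ultimately show ?case
      using Henstock_Kurzweil_Integration.integrable_combine by blast
  qed
  show ?thesis
    unfolding locally_integrable_def
  proof (intro allI)
    fix a b :: real
    obtain n :: nat where n: "max \<bar>a\<bar> \<bar>b\<bar> \<le> real n" using real_arch_simple by blast
    have "real n \<le> 2 * pi * real n"
      using pi_ge_two mult_right_mono[of 1 "2 * pi" "real n"] by simp
    then have "{a..b} \<subseteq> {- (2 * pi * real n + pi)..2 * pi * real n + pi}"
      using n pi_gt_zero unfolding atLeastatMost_subset_iff by linarith
    then show "f integrable_on {a..b}"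
      using sym[of n] by (rule integrable_on_subinterval[rotated])
  qed
qed

lemma HK_diff: "f \<in> HK \<Longrightarrow> g \<in> HK \<Longrightarrow> (\<lambda>x. f x - g x) \<in> HK"
  by (auto simp: HK_def intro: Henstock_Kurzweil_Integration.integrable_diff)

lemma primitive_shift_period:
  assumes "f \<in> HK"
  shows "primitive f (y + 2 * pi) - primitive f (x + 2 * pi) = primitive f y - primitive f x"
proof -
  have *: "primitive f (y + 2 * pi) - primitive f (x + 2 * pi) = primitive f y - primitive f x"
    if "x \<le> y" for x y
  proof -
    have "f \<circ> (+) (2 * pi) = f"
      using HK_periodic[OF assms] by (auto simp: fun_eq_iff add.commute)
    then have "integral {x + 2 * pi..y + 2 * pi} f = integral {x..y} f"
      by (metis integral_shift_Icc_real)
    then show ?thesis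
      using primitive_diff[OF HK_locally_integrable[OF assms]] that by simp
  qed
  show ?thesis
    using *[of x y] *[of y x] by linarith
qed

lemma integral_period_shift:
  assumes "f \<in> HK"
  shows "integral {c - pi..c + pi} f = integral {-pi..pi} f"
  using primitive_shift_period[OF assms, of "c - pi" "-pi"]
    primitive_diff[OF HK_locally_integrable[OF assms], of "c - pi" "c + pi"]
    primitive_diff[OF HK_locally_integrable[OF assms], of "-pi" pi]
  by (simp add: algebra_simps)

text \<open>The primitive need not be periodic, since the integral over a period may be nonzero, but
  its increments are. Uniform continuity on one period with a margin therefore carries over to the
  whole line.\<close>

lemma primitive_uniformly_continuous:
  assumes f: "f \<in> HK" and "e > 0"
  obtains d where "d > 0" "\<And>x t. \<bar>t\<bar> < d \<Longrightarrow> \<bar>primitive f (x + t) - primitive f x\<bar> < e"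
proof -
  have "uniformly_continuous_on {-1..2 * pi + 1} (primitive f)"
    by (intro compact_uniformly_continuous continuous_on_primitive HK_locally_integrable f) auto
  then obtain d where "d > 0" and d: "\<And>x y. x \<in> {-1..2 * pi + 1} \<Longrightarrow> y \<in> {-1..2 * pi + 1} \<Longrightarrow>
      \<bar>y - x\<bar> < d \<Longrightarrow> \<bar>primitive f y - primitive f x\<bar> < e"
    using \<open>e > 0\<close> unfolding uniformly_continuous_on_def dist_real_def by metis
  have shift: "primitive f (y + 2 * pi * of_int k) - primitive f (x + 2 * pi * of_int k)
      = primitive f y - primitive f x" for x y k
  proof (induction k rule: int_induct[of _ 0])
    case (step1 i)
    then show ?case
      using primitive_shift_period[OF f, of "y + 2 * pi * of_int i" "x + 2 * pi * of_int i"]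
      by (simp add: algebra_simps)
  next
    case (step2 i)
    then show ?case
      using primitive_shift_period[OF f, of "y + 2 * pi * of_int (i - 1)" "x + 2 * pi * of_int (i - 1)"]
      by (simp add: algebra_simps)
  qed simp
  \<comment> \<open>The cap 1 matches the margin of the compact interval: with \<open>z\<close> in
    one period, \<open>z + t\<close> stays inside it.\<close>
  have "\<bar>primitive f (x + t) - primitive f x\<bar> < e" if t: "\<bar>t\<bar> < min d 1" for x t
  proof -
    define k where "k = \<lfloor>x / (2 * pi)\<rfloor>"
    define z where "z = x - 2 * pi * of_int k"
    have "of_int k \<le> x / (2 * pi)" "x / (2 * pi) < of_int k + 1"
      unfolding k_def by linarith+
    then have "0 \<le> z" "z \<le> 2 * pi"
      by (simp_all add: z_def field_simps)
    then have "\<bar>primitive f (z + t) - primitive f z\<bar> < e"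
      using t by (intro d) auto
    then show ?thesis
      using shift[of "z + t" k z] by (simp add: z_def algebra_simps)
  qed
  with \<open>d > 0\<close> show thesis by (intro that[of "min d 1"]) auto
qed

section \<open>Interval bounds and the Alexiewicz norm\<close>

lemma alexiewicz_norm_le:
  assumes "\<And>a b. a \<le> b \<Longrightarrow> b - a \<le> 2 * pi \<Longrightarrow> \<bar>integral {a..b} f\<bar> \<le> B"
  shows "alexiewicz_norm f \<le> B"
  unfolding alexiewicz_norm_def
  by (rule cSUP_least) (use assms in \<open>auto intro!: exI[of _ 0]\<close>)

lemma integral_le_alexiewicz_norm:
  assumes "f \<in> HK" "a \<le> b" "b - a \<le> 2 * pi"
  shows "\<bar>integral {a..b} f\<bar> \<le> alexiewicz_norm f"
  using cSUP_upper[OF _ HK_bdd_above[OF assms(1)], of "(a, b)"] assms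
  by (auto simp: alexiewicz_norm_def)

lemma alexiewicz_norm_nonneg: "f \<in> HK \<Longrightarrow> 0 \<le> alexiewicz_norm f"
  using integral_le_alexiewicz_norm[of f 0 0] by simp

text \<open>The bound \<open>C\<close> on the derivative is what lets integration by parts write
  \<open>K\<close> as a difference of increasing functions.\<close>

locale periodic_kernel =
  fixes K K' :: "real \<Rightarrow> real" and C :: real
  assumes deriv: "\<And>x. (K has_real_derivative K' x) (at x)"
    and cont: "continuous_on UNIV K'"
    and bound: "\<And>x. \<bar>K' x\<bar> \<le> C"
    and period: "\<And>x. K (x + 2 * pi) = K x"
begin

lemma continuous_on_kernel: "continuous_on S K"
  by (meson DERIV_isCont continuous_at_imp_continuous_on deriv)

lemma continuous_on_kernel': "continuous_on S K'"
  using cont by (rule continuous_on_subset) simp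

definition convolution :: "(real \<Rightarrow> real) \<Rightarrow> real \<Rightarrow> real" where
  "convolution f \<theta> = integral {-pi..pi} (\<lambda>\<phi>. f \<phi> * K (\<phi> - \<theta>))"

lemma has_integral_product:
  assumes f: "locally_integrable f" and "a \<le> b"
  shows "((\<lambda>\<phi>. f \<phi> * K (\<phi> - \<theta>)) has_integral primitive f b * K (b - \<theta>) - primitive f a * K (a - \<theta>)
      - integral {a..b} (\<lambda>\<phi>. primitive f \<phi> * K' (\<phi> - \<theta>))) {a..b}"
proof (rule has_integral_by_parts[OF f _ _ _ \<open>a \<le> b\<close>])
  show "((\<lambda>\<phi>. K (\<phi> - \<theta>)) has_real_derivative K' (x - \<theta>)) (at x)" for x
    using DERIV_shift[of K "K' (x - \<theta>)" x "- \<theta>"] deriv by simp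
  show "continuous_on UNIV (\<lambda>\<phi>. K' (\<phi> - \<theta>))"
    by (intro continuous_on_compose2[OF cont] continuous_intros) auto
qed (rule bound)

text \<open>Membership in \<open>HK\<close>, beyond integrability over one period, allows the window
  of integration to be moved by \<open>integral_period_shift\<close>.\<close>

lemma product_in_HK:
  assumes "f \<in> HK"
  shows "(\<lambda>\<phi>. f \<phi> * K (\<phi> - \<theta>)) \<in> HK"
proof -
  have "K (x + 2 * pi - \<theta>) = K (x - \<theta>)" for x
    using period[of "x - \<theta>"] by (simp add: algebra_simps)
  then show ?thesis
    using has_integral_product[OF HK_locally_integrable[OF assms], of "-pi" pi \<theta>]
    by (auto simp: HK_def HK_periodic[OF assms] has_integral_integrable_integral)
qed

text \<open>Centring the period at \<theta> before substituting leaves \<theta> only in the argument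
  of the primitive, so that every function still integrated is continuous.\<close>

lemma convolution_by_parts:
  assumes f: "f \<in> HK"
  shows "convolution f \<theta> = primitive f (\<theta> + pi) * K pi - primitive f (\<theta> - pi) * K (- pi)
    - integral {-pi..pi} (\<lambda>t. primitive f (\<theta> + t) * K' t)"
proof -
  have "convolution f \<theta> = integral {\<theta> - pi..\<theta> + pi} (\<lambda>\<phi>. f \<phi> * K (\<phi> - \<theta>))"
    unfolding convolution_def by (rule integral_period_shift[OF product_in_HK[OF f], symmetric])
  also have "\<dots> = primitive f (\<theta> + pi) * K pi - primitive f (\<theta> - pi) * K (- pi)
      - integral {\<theta> - pi..\<theta> + pi} (\<lambda>\<phi>. primitive f \<phi> * K' (\<phi> - \<theta>))"
    using has_integral_product[OF HK_locally_integrable[OF f], of "\<theta> - pi" "\<theta> + pi" \<theta>]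
    by (simp add: has_integral_integrable_integral)
  also have "integral {\<theta> - pi..\<theta> + pi} (\<lambda>\<phi>. primitive f \<phi> * K' (\<phi> - \<theta>))
      = integral {-pi..pi} (\<lambda>t. primitive f (\<theta> + t) * K' t)"
    using integral_shift_Icc_real[of "-pi" pi "\<lambda>\<phi>. primitive f \<phi> * K' (\<phi> - \<theta>)" \<theta>]
    by (simp add: o_def add.commute)
  finally show ?thesis .
qed

text \<open>The primitive \<open>G\<close> of \<open>f\<close> is only continuous, so the integral
  of \<open>G (\<theta> + t) * K t\<close> cannot be differentiated under the integral sign
  directly. A further integration by parts replaces \<open>G\<close> by its own primitive
  \<open>P\<close>, which is continuously differentiable. Differentiating then turns
  \<open>P\<close> back into \<open>G\<close>, and the result is the expression of
  \<open>convolution_by_parts\<close>.\<close>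

lemma DERIV_smoothed_primitive:
  assumes f: "f \<in> HK"
  shows "((\<lambda>\<theta>. integral {-pi..pi} (\<lambda>t. primitive f (\<theta> + t) * K t)) has_real_derivative
    convolution f \<theta>) (at \<theta>)"
proof -
  define G where "G = primitive f"
  define P where "P = primitive G"
  have G: "continuous_on S G" for S
    unfolding G_def by (intro continuous_on_primitive HK_locally_integrable f)
  have dP: "(P has_real_derivative G x) (at x)" for x
    unfolding P_def by (rule DERIV_primitive[OF G])
  have dP1: "((\<lambda>t. P (\<theta> + t)) has_real_derivative G (\<theta> + t)) (at t within S)" for \<theta> t S
    using DERIV_shift[of P "G (\<theta> + t)" t \<theta>] dP[of "\<theta> + t"]
    by (auto simp: add.commute intro: has_field_derivative_at_within)
  have dP2: "((\<lambda>\<theta>. P (\<theta> + t)) has_real_derivative G (\<theta> + t)) (at \<theta> within S)" for \<theta> t S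
    using DERIV_shift[of P "G (\<theta> + t)" \<theta> t] dP[of "\<theta> + t"]
    by (auto simp: intro: has_field_derivative_at_within)
  have P: "continuous_on S P" for S
    by (meson DERIV_isCont continuous_at_imp_continuous_on dP)
  have ci: "continuous_on S (\<lambda>t. G (\<theta> + t) * K t)" "continuous_on S (\<lambda>t. P (\<theta> + t) * K' t)" for S \<theta>
    by (intro continuous_intros continuous_on_kernel continuous_on_kernel'
        continuous_on_compose2[OF G[of UNIV]] continuous_on_compose2[OF P[of UNIV]]; simp)+
  have V: "integral {-pi..pi} (\<lambda>t. G (\<theta> + t) * K t)
      = P (\<theta> + pi) * K pi - P (\<theta> + - pi) * K (-pi) - integral {-pi..pi} (\<lambda>t. P (\<theta> + t) * K' t)" for \<theta>
  proof -
    have "((\<lambda>t. G (\<theta> + t) * K t + P (\<theta> + t) * K' t) has_integral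
        P (\<theta> + pi) * K pi - P (\<theta> + - pi) * K (-pi)) {-pi..pi}"
      by (rule has_integral_FTC) (auto intro!: derivative_eq_intros deriv dP1)
    then have "P (\<theta> + pi) * K pi - P (\<theta> + - pi) * K (-pi)
        = integral {-pi..pi} (\<lambda>t. G (\<theta> + t) * K t + P (\<theta> + t) * K' t)"
      by (simp add: has_integral_integrable_integral)
    also have "\<dots> = integral {-pi..pi} (\<lambda>t. G (\<theta> + t) * K t) + integral {-pi..pi} (\<lambda>t. P (\<theta> + t) * K' t)"
      by (intro Henstock_Kurzweil_Integration.integral_add integrable_continuous_real ci)
    finally show ?thesis by simp
  qed
  have "((\<lambda>\<theta>. integral (cbox (-pi) pi) (\<lambda>t. P (\<theta> + t) * K' t)) has_field_derivative
      integral (cbox (-pi) pi) (\<lambda>t. G (\<theta> + t) * K' t)) (at \<theta> within UNIV)"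
  proof (rule leibniz_rule_field_derivative)
    show "((\<lambda>\<theta>. P (\<theta> + t) * K' t) has_real_derivative G (\<theta> + t) * K' t) (at \<theta> within UNIV)" for \<theta> t
      by (rule DERIV_cmult_right[OF dP2])
    show "(\<lambda>t. P (\<theta> + t) * K' t) integrable_on cbox (- pi) pi" for \<theta>
      by (simp add: integrable_continuous_real ci)
    show "continuous_on (UNIV \<times> cbox (- pi) pi) (\<lambda>(x, t). G (x + t) * K' t)"
      unfolding case_prod_beta
      by (intro continuous_intros continuous_on_compose2[OF G[of UNIV]]
            continuous_on_compose2[OF continuous_on_kernel'[of UNIV]]; simp)
  qed auto
  then have "((\<lambda>\<theta>. P (\<theta> + pi) * K pi - P (\<theta> + - pi) * K (-pi) - integral {-pi..pi} (\<lambda>t. P (\<theta> + t) * K' t))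
    has_real_derivative G (\<theta> + pi) * K pi - G (\<theta> + - pi) * K (-pi)
      - integral {-pi..pi} (\<lambda>t. G (\<theta> + t) * K' t)) (at \<theta>)"
    by (intro DERIV_diff DERIV_cmult_right dP2) simp
  then show ?thesis
    unfolding convolution_by_parts[OF f] V[symmetric] by (simp add: G_def)
qed

lemma has_integral_convolution:
  assumes f: "f \<in> HK" and "a \<le> b"
  shows "(convolution f has_integral
    integral {-pi..pi} (\<lambda>t. (primitive f (b + t) - primitive f (a + t)) * K t)) {a..b}"
proof -
  have "(\<lambda>t. primitive f (c + t) * K t) integrable_on {-pi..pi}" for c
    by (intro integrable_continuous_real continuous_intros continuous_on_kernel
        continuous_on_compose2[OF continuous_on_primitive[OF HK_locally_integrable[OF f], of UNIV]]) auto
  then have "integral {-pi..pi} (\<lambda>t. primitive f (b + t) * K t) - integral {-pi..pi} (\<lambda>t. primitive f (a + t) * K t)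
      = integral {-pi..pi} (\<lambda>t. (primitive f (b + t) - primitive f (a + t)) * K t)"
    by (subst Henstock_Kurzweil_Integration.integral_diff[symmetric]) (simp_all add: left_diff_distrib)
  then show ?thesis
    using has_integral_FTC[OF \<open>a \<le> b\<close> DERIV_smoothed_primitive[OF f]] by simp
qed

lemma convolution_in_HK:
  assumes "f \<in> HK"
  shows "convolution f \<in> HK"
proof -
  have "K (x - (\<theta> + 2 * pi)) = K (x - \<theta>)" for x \<theta>
    using period[of "x - (\<theta> + 2 * pi)"] by (simp add: algebra_simps)
  then show ?thesis
    using has_integral_convolution[OF assms, of "-pi" pi]
    by (auto simp: HK_def convolution_def has_integral_integrable_integral)
qed

end

subsection \<open>The Poisson integral\<close>

text \<open>The right-hand side is the squared distance from 1 to the point of modulus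
  \<open>r\<close> and argument \<theta>, which is least at angle 0.\<close>

lemma poisson_denominator_ge:
  assumes "0 \<le> (r::real)"
  shows "(1 - r)\<^sup>2 \<le> 1 - 2 * r * cos \<theta> + r\<^sup>2"
  using mult_left_mono[OF cos_le_one assms, of \<theta>] by (simp add: power2_eq_square algebra_simps)

lemma poisson_denominator_pos:
  assumes "0 \<le> (r::real)" "r < 1"
  shows "0 < 1 - 2 * r * cos \<theta> + r\<^sup>2"
  using poisson_denominator_ge[OF assms(1), of \<theta>] assms by (smt (verit) zero_less_power2)

lemma poisson_kernel_nonneg:
  assumes "0 \<le> r" "r < 1"
  shows "0 \<le> poisson_kernel r \<theta>"
  using poisson_denominator_pos[OF assms, of \<theta>] assms
  by (auto simp: poisson_kernel_def power_le_one intro!: divide_nonneg_pos mult_nonneg_nonneg)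

lemma poisson_kernel_le:
  assumes "0 \<le> r" "r < 1" and "0 < m" "m \<le> 1 - 2 * r * cos \<theta> + r\<^sup>2"
  shows "poisson_kernel r \<theta> \<le> (1 - r\<^sup>2) / (2 * pi * m)"
  unfolding poisson_kernel_def
  using assms by (intro divide_left_mono mult_left_mono mult_pos_pos) (auto simp: power_le_one)

lemma poisson_kernel_le_peak:
  assumes "0 \<le> r" "r < 1"
  shows "poisson_kernel r \<theta> \<le> 1 / (pi * (1 - r))"
proof -
  have "poisson_kernel r \<theta> \<le> (1 - r\<^sup>2) / (2 * pi * (1 - r)\<^sup>2)"
    using assms by (intro poisson_kernel_le poisson_denominator_ge) auto
  also have "\<dots> = (1 + r) / (2 * pi * (1 - r))"
    using assms by (simp add: divide_simps) (simp add: power2_eq_square algebra_simps)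
  also have "\<dots> \<le> 2 / (2 * pi * (1 - r))"
    using assms by (intro divide_right_mono) auto
  finally show ?thesis by simp
qed

text \<open>The cosine decreases on \<open>{0..pi}\<close>, so the denominator grows with the
  absolute value of the angle.\<close>

lemma poisson_kernel_le_off_peak:
  assumes "0 \<le> r" "r < 1" and "0 \<le> \<delta>" "\<delta> \<le> \<bar>\<theta>\<bar>" "\<bar>\<theta>\<bar> \<le> pi"
  shows "poisson_kernel r \<theta> \<le> poisson_kernel r \<delta>"
proof -
  have "cos \<bar>\<theta>\<bar> \<le> cos \<delta>"
    using assms by (intro cos_monotone_0_pi_le) auto
  then have "cos \<theta> \<le> cos \<delta>" by (simp add: abs_if split: if_splits)
  then have "2 * r * cos \<theta> \<le> 2 * r * cos \<delta>"
    using \<open>0 \<le> r\<close> by (intro mult_left_mono) auto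
  then show ?thesis
    unfolding poisson_kernel_def[of r \<delta>]
    using assms by (intro poisson_kernel_le poisson_denominator_pos) auto
qed

text \<open>The numerator tends to 0, while the hypothesis keeps the limit
  \<open>2 - 2 * cos \<delta>\<close> of the cosine factor in the denominator away from 0.\<close>

lemma poisson_kernel_tendsto_0:
  assumes "cos \<delta> < 1"
  shows "((\<lambda>r. poisson_kernel r \<delta>) \<longlongrightarrow> 0) (at_left 1)"
  unfolding poisson_kernel_def using assms by (auto intro!: tendsto_eq_intros)

lemma has_integral_poisson_kernel:
  assumes "0 \<le> r" "r < 1"
  shows "(poisson_kernel r has_integral 1) {-pi..pi}"
proof -
  \<comment> \<open>With \<open>z = r e\<^sup>i\<^sup>t\<close>, the kernel is \<open>Re (1 + 2 z / (1 - z)) / 2\<pi>\<close>, and \<open>arctan\<close> is \<open>- Arg (1 - z)\<close>.\<close>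
  define F where "F t = (t + 2 * arctan (r * sin t / (1 - r * cos t))) / (2 * pi)" for t
  have "(F has_real_derivative poisson_kernel r t) (at t)" for t
  proof -
    have "r * cos t \<le> r" using mult_left_mono[OF cos_le_one assms(1), of t] by simp
    then have p: "0 < 1 - r * cos t" using assms by linarith
    define D where "D = 1 - 2 * r * cos t + r\<^sup>2"
    have D: "D > 0" unfolding D_def by (rule poisson_denominator_pos[OF assms])
    have cs: "sin t * sin t = 1 - cos t * cos t"
      using sin_cos_squared_add[of t] by (simp add: power2_eq_square)
    have rr: "r * (r * (sin t * sin t)) = r * r - r * (r * (cos t * cos t))"
      unfolding cs by (simp add: algebra_simps)
    have q: "((\<lambda>t. r * sin t / (1 - r * cos t)) has_real_derivative
        (r * cos t - r\<^sup>2) / (1 - r * cos t)\<^sup>2) (at t)"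
    proof -
      show ?thesis
        using p by (auto intro!: derivative_eq_intros simp: power2_eq_square algebra_simps rr)
    qed
    have "(1 - r * cos t)\<^sup>2 + (r * sin t)\<^sup>2 = D"
      by (simp add: D_def power2_eq_square algebra_simps rr)
    then have "1 + (r * sin t / (1 - r * cos t))\<^sup>2 = D / (1 - r * cos t)\<^sup>2"
      using p by (simp add: field_simps)
    then have "inverse (1 + (r * sin t / (1 - r * cos t))\<^sup>2) * ((r * cos t - r\<^sup>2) / (1 - r * cos t)\<^sup>2)
        = (r * cos t - r\<^sup>2) / D"
      using p D by (simp add: field_simps)
    then have "(F has_real_derivative (1 + 2 * ((r * cos t - r\<^sup>2) / D)) / (2 * pi)) (at t)"
      unfolding F_def using DERIV_chain2[OF DERIV_arctan q]
      by (intro DERIV_cdivide DERIV_add DERIV_cmult DERIV_ident) simp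
    moreover have "(1 + 2 * ((r * cos t - r\<^sup>2) / D)) / (2 * pi) = poisson_kernel r t"
    proof -
      have "1 + 2 * ((r * cos t - r\<^sup>2) / D) = (1 - r\<^sup>2) / D"
        using D by (simp add: divide_simps) (simp add: D_def)
      then show ?thesis by (simp add: poisson_kernel_def flip: D_def)
    qed
    ultimately show ?thesis by simp
  qed
  then have "(poisson_kernel r has_integral F pi - F (- pi)) {-pi..pi}"
    by (intro has_integral_FTC) auto
  \<comment> \<open>The sine vanishes at both endpoints, so the \<open>arctan\<close> terms drop out
    and only the linear part of \<open>F\<close> contributes.\<close>
  then show ?thesis by (simp add: F_def field_simps)
qed

text \<open>The constant combines the bound 1 on the sine with the least value
  \<open>(1 - r)\<^sup>2\<close> of the denominator. It blows up as \<open>r\<close> tends to 1,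
  which is harmless because \<open>r\<close> is fixed whenever the locale is applied.\<close>

lemma periodic_kernel_poisson:
  assumes "0 \<le> r" "r < 1"
  shows "periodic_kernel (poisson_kernel r)
    (\<lambda>t. - (1 - r\<^sup>2) * (2 * r * sin t) / (2 * pi * (1 - 2 * r * cos t + r\<^sup>2)\<^sup>2))
    ((1 - r\<^sup>2) * (2 * r) / (2 * pi * ((1 - r)\<^sup>2)\<^sup>2))"
proof
  note pos = poisson_denominator_pos[OF assms]
  then have nz: "1 - 2 * r * cos t + r\<^sup>2 \<noteq> 0" for t
    by (metis less_irrefl)
  have "((\<lambda>t. c / (2 * pi * (1 - 2 * r * cos t + r\<^sup>2))) has_real_derivative
      - c * (2 * r * sin t) / (2 * pi * (1 - 2 * r * cos t + r\<^sup>2)\<^sup>2)) (at t)" for c t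
    using nz[of t] by (auto intro!: derivative_eq_intros simp: power2_eq_square) (simp add: mult_ac)
  then show "(poisson_kernel r has_real_derivative
      - (1 - r\<^sup>2) * (2 * r * sin t) / (2 * pi * (1 - 2 * r * cos t + r\<^sup>2)\<^sup>2)) (at t)" for t
    unfolding poisson_kernel_def .
  show "continuous_on UNIV (\<lambda>t. - (1 - r\<^sup>2) * (2 * r * sin t) / (2 * pi * (1 - 2 * r * cos t + r\<^sup>2)\<^sup>2))"
    using nz by (auto intro!: continuous_intros)
  show "\<bar>- (1 - r\<^sup>2) * (2 * r * sin t) / (2 * pi * (1 - 2 * r * cos t + r\<^sup>2)\<^sup>2)\<bar>
      \<le> (1 - r\<^sup>2) * (2 * r) / (2 * pi * ((1 - r)\<^sup>2)\<^sup>2)" for t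
  proof -
    have "\<bar>- (1 - r\<^sup>2) * (2 * r * sin t) / (2 * pi * (1 - 2 * r * cos t + r\<^sup>2)\<^sup>2)\<bar>
        = (1 - r\<^sup>2) * (2 * r * \<bar>sin t\<bar>) / (2 * pi * (1 - 2 * r * cos t + r\<^sup>2)\<^sup>2)"
      using assms by (simp add: abs_mult power_le_one abs_le_square_iff)
    also have "\<dots> \<le> (1 - r\<^sup>2) * (2 * r * 1) / (2 * pi * ((1 - r)\<^sup>2)\<^sup>2)"
      using assms pos[of t] poisson_denominator_ge[OF assms(1), of t]
      by (intro frac_le mult_left_mono mult_nonneg_nonneg power_mono mult_pos_pos)
        (auto simp: power_le_one abs_sin_le_one)
    finally show ?thesis by simp
  qed
  show "poisson_kernel r (t + 2 * pi) = poisson_kernel r t" for t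
    by (simp add: poisson_kernel_def)
qed

lemma
  assumes "f \<in> HK" "0 \<le> r" "r < 1"
  shows poisson_product_integrable: "(\<lambda>\<phi>. f \<phi> * poisson_kernel r (\<phi> - \<theta>)) integrable_on {-pi..pi}"
    and poisson_integral_in_HK: "poisson_integral f r \<in> HK"
    and has_integral_poisson_integral: "a \<le> b \<Longrightarrow> (poisson_integral f r has_integral
      integral {-pi..pi} (\<lambda>t. (primitive f (b + t) - primitive f (a + t)) * poisson_kernel r t)) {a..b}"
proof -
  interpret periodic_kernel "poisson_kernel r"
    "\<lambda>t. - (1 - r\<^sup>2) * (2 * r * sin t) / (2 * pi * (1 - 2 * r * cos t + r\<^sup>2)\<^sup>2)"
    "(1 - r\<^sup>2) * (2 * r) / (2 * pi * ((1 - r)\<^sup>2)\<^sup>2)"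
    by (rule periodic_kernel_poisson[OF assms(2,3)])
  have eq: "poisson_integral f r = convolution f"
    by (simp add: poisson_integral_def convolution_def fun_eq_iff)
  show "(\<lambda>\<phi>. f \<phi> * poisson_kernel r (\<phi> - \<theta>)) integrable_on {-pi..pi}"
    by (rule locally_integrableD[OF HK_locally_integrable[OF product_in_HK[OF assms(1)]]])
  show "poisson_integral f r \<in> HK"
    unfolding eq by (rule convolution_in_HK[OF assms(1)])
  show "(poisson_integral f r has_integral
      integral {-pi..pi} (\<lambda>t. (primitive f (b + t) - primitive f (a + t)) * poisson_kernel r t)) {a..b}"
    if "a \<le> b"
    unfolding eq by (rule has_integral_convolution[OF assms(1) that])
qed

section \<open>Norm estimates for the Poisson integral\<close>

lemma continuous_on_poisson_kernel:
  assumes "0 \<le> r" "r < 1"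
  shows "continuous_on S (poisson_kernel r)"
  using periodic_kernel.continuous_on_kernel[OF periodic_kernel_poisson[OF assms]] .

lemma increment_bound:
  assumes "f \<in> HK" "a \<le> b" "b - a \<le> 2 * pi"
  shows "\<bar>primitive f (b + t) - primitive f (a + t)\<bar> \<le> alexiewicz_norm f"
  using integral_le_alexiewicz_norm[OF assms(1), of "a + t" "b + t"]
    primitive_diff[OF HK_locally_integrable[OF assms(1)], of "a + t" "b + t"] assms by simp

lemma continuous_on_increment:
  assumes "f \<in> HK"
  shows "continuous_on S (\<lambda>t. primitive f (b + t) - primitive f (a + t))"
  by (intro continuous_intros
      continuous_on_compose2[OF continuous_on_primitive[OF HK_locally_integrable[OF assms], of UNIV]]) auto

lemma alexiewicz_norm_poisson_integral_le:
  assumes f: "f \<in> HK" and r: "0 \<le> r" "r < 1"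
  shows "alexiewicz_norm (poisson_integral f r) \<le> alexiewicz_norm f"
proof (rule alexiewicz_norm_le)
  fix a b :: real assume ab: "a \<le> b" "b - a \<le> 2 * pi"
  let ?g = "\<lambda>t. (primitive f (b + t) - primitive f (a + t)) * poisson_kernel r t"
  have "norm (integral {-pi..pi} ?g) \<le> integral {-pi..pi} (\<lambda>t. alexiewicz_norm f * poisson_kernel r t)"
  proof (rule Henstock_Kurzweil_Integration.integral_norm_bound_integral)
    show "?g integrable_on {-pi..pi}"
      by (intro integrable_continuous_real continuous_on_mult continuous_on_increment f
          continuous_on_poisson_kernel r)
    show "(\<lambda>t. alexiewicz_norm f * poisson_kernel r t) integrable_on {-pi..pi}"
      by (intro integrable_continuous_real continuous_intros continuous_on_poisson_kernel r)
    show "norm (?g t) \<le> alexiewicz_norm f * poisson_kernel r t" for t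
      using increment_bound[OF f ab] poisson_kernel_nonneg[OF r]
      by (simp add: abs_mult mult_right_mono)
  qed
  also have "\<dots> = alexiewicz_norm f"
    using has_integral_poisson_kernel[OF r] by (simp add: has_integral_integrable_integral)
  finally show "\<bar>integral {a..b} (poisson_integral f r)\<bar> \<le> alexiewicz_norm f"
    using has_integral_poisson_integral[OF f r ab(1)] by (simp add: has_integral_integrable_integral)
qed

text \<open>With \<open>G t\<close> the increment of the primitive from \<open>a + t\<close> to
  \<open>b + t\<close>, the error over \<open>{a..b}\<close> is the kernel average of
  \<open>G t - G 0\<close>. Within \<delta> of 0 this difference is at most \<open>2 * e\<close>,
  one \<open>e\<close> for each endpoint. Elsewhere it is at most twice the norm, and the kernel is
  at most its value at \<delta>; integrating over length \<open>2 * pi\<close> gives the factor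
  \<open>4 * pi\<close>.\<close>

lemma alexiewicz_norm_poisson_diff_le:
  assumes f: "f \<in> HK" and r: "0 \<le> r" "r < 1"
    and \<delta>: "0 < \<delta>" and osc: "\<And>x t. \<bar>t\<bar> < \<delta> \<Longrightarrow> \<bar>primitive f (x + t) - primitive f x\<bar> \<le> e"
  shows "alexiewicz_norm (\<lambda>\<theta>. poisson_integral f r \<theta> - f \<theta>)
    \<le> 2 * e + 4 * pi * alexiewicz_norm f * poisson_kernel r \<delta>"
proof (rule alexiewicz_norm_le)
  fix a b :: real assume ab: "a \<le> b" "b - a \<le> 2 * pi"
  define G where "G t = primitive f (b + t) - primitive f (a + t)" for t
  define N where "N = alexiewicz_norm f"
  have e: "0 \<le> e" using osc[of 0 0] \<delta> by simp
  have N: "0 \<le> N" unfolding N_def by (rule alexiewicz_norm_nonneg[OF f])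
  have cont: "continuous_on S G" for S
    unfolding G_def by (rule continuous_on_increment[OF f])
  have i1: "((\<lambda>t. G t * poisson_kernel r t) has_integral integral {a..b} (poisson_integral f r)) {-pi..pi}"
    using has_integral_poisson_integral[OF f r ab(1)]
    by (simp add: has_integral_integrable_integral G_def[abs_def, symmetric] G_def[symmetric])
      (intro integrable_continuous_real continuous_on_mult cont continuous_on_poisson_kernel r)
  have i2: "((\<lambda>t. G 0 * poisson_kernel r t) has_integral G 0 * 1) {-pi..pi}"
    by (intro has_integral_mult_right has_integral_poisson_kernel r)
  have G0: "G 0 = integral {a..b} f"
    using primitive_diff[OF HK_locally_integrable[OF f] ab(1)] by (simp add: G_def)
  \<comment> \<open>The sum of the near and far bounds dominates at every point, so the integral
    need not be split at distance \<delta>.\<close>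
  have i3: "((\<lambda>t. 2 * e * poisson_kernel r t + 2 * N * poisson_kernel r \<delta>) has_integral
      2 * e * 1 + 2 * pi * (2 * N * poisson_kernel r \<delta>)) {-pi..pi}"
    using has_integral_const_real[of "2 * N * poisson_kernel r \<delta>" "-pi" pi]
    by (intro has_integral_add has_integral_mult_right has_integral_poisson_kernel r) simp
  have pw: "norm (G t * poisson_kernel r t - G 0 * poisson_kernel r t)
      \<le> 2 * e * poisson_kernel r t + 2 * N * poisson_kernel r \<delta>" if t: "t \<in> {-pi..pi}" for t
  proof -
    note nn = poisson_kernel_nonneg[OF r]
    have eq: "norm (G t * poisson_kernel r t - G 0 * poisson_kernel r t) = \<bar>G t - G 0\<bar> * poisson_kernel r t"
      using nn by (simp add: abs_mult flip: left_diff_distrib)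
    show ?thesis
    proof (cases "\<bar>t\<bar> < \<delta>")
      case True
      have "\<bar>G t - G 0\<bar> \<le> 2 * e"
        using osc[OF True, of a] osc[OF True, of b] by (simp add: G_def)
      then have "\<bar>G t - G 0\<bar> * poisson_kernel r t \<le> 2 * e * poisson_kernel r t"
        by (rule mult_right_mono) (rule nn)
      then show ?thesis using eq mult_nonneg_nonneg[OF N nn[of \<delta>]] by simp
    next
      case False
      have "\<bar>G t - G 0\<bar> \<le> 2 * N"
        using increment_bound[OF f ab, of t] increment_bound[OF f ab, of 0] unfolding G_def N_def by linarith
      moreover have "poisson_kernel r t \<le> poisson_kernel r \<delta>"
        using t \<delta> False by (intro poisson_kernel_le_off_peak r) auto
      ultimately have "\<bar>G t - G 0\<bar> * poisson_kernel r t \<le> 2 * N * poisson_kernel r \<delta>"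
        using N nn by (intro mult_mono) auto
      then show ?thesis using eq mult_nonneg_nonneg[OF e nn[of t]] by simp
    qed
  qed
  have "norm (integral {a..b} (poisson_integral f r) - G 0 * 1)
      \<le> 2 * e * 1 + 2 * pi * (2 * N * poisson_kernel r \<delta>)"
    using Henstock_Kurzweil_Integration.integral_norm_bound_integral
        [OF has_integral_integrable has_integral_integrable pw, OF has_integral_diff[OF i1 i2] i3]
    by (simp only: integral_unique[OF has_integral_diff[OF i1 i2]] integral_unique[OF i3])
  moreover have "integral {a..b} (\<lambda>\<theta>. poisson_integral f r \<theta> - f \<theta>)
      = integral {a..b} (poisson_integral f r) - integral {a..b} f"
    by (intro Henstock_Kurzweil_Integration.integral_diff locally_integrableD HK_locally_integrable
        poisson_integral_in_HK f r)
  ultimately show "\<bar>integral {a..b} (\<lambda>\<theta>. poisson_integral f r \<theta> - f \<theta>)\<bar>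
      \<le> 2 * e + 4 * pi * alexiewicz_norm f * poisson_kernel r \<delta>"
    by (simp add: G0 N_def)
qed

lemma poisson_integral_tendsto:
  assumes f: "f \<in> HK"
  shows "((\<lambda>r. alexiewicz_norm (\<lambda>\<theta>. poisson_integral f r \<theta> - f \<theta>)) \<longlongrightarrow> 0) (at_left 1)"
proof (rule tendstoI)
  fix e :: real assume "0 < e"
  then obtain d where d: "d > 0" "\<And>x t. \<bar>t\<bar> < d \<Longrightarrow> \<bar>primitive f (x + t) - primitive f x\<bar> < e / 4"
    using primitive_uniformly_continuous[OF f, of "e / 4"] by auto
  \<comment> \<open>The cap 1 keeps \<delta> below \<open>pi\<close>, where
    \<open>cos \<delta> < 1\<close> is available. The near part then costs \<open>e / 2\<close>,
    leaving room for the vanishing far part.\<close>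
  define \<delta> where "\<delta> = min d 1"
  have \<delta>: "\<delta> > 0" "\<delta> \<le> 1" using d by (auto simp: \<delta>_def)
  have "cos \<delta> < cos 0"
    using \<delta> pi_gt3 by (intro cos_monotone_0_pi) auto
  then have "((\<lambda>r. 2 * (e / 4) + 4 * pi * alexiewicz_norm f * poisson_kernel r \<delta>) \<longlongrightarrow>
      2 * (e / 4) + 4 * pi * alexiewicz_norm f * 0) (at_left 1)"
    by (intro tendsto_intros poisson_kernel_tendsto_0) simp
  then have "\<forall>\<^sub>F r in at_left 1. 2 * (e / 4) + 4 * pi * alexiewicz_norm f * poisson_kernel r \<delta> < e"
    by (rule order_tendstoD) (use \<open>e > 0\<close> in simp)
  moreover have "\<forall>\<^sub>F r in at_left (1::real). r \<in> {0<..<1}"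
    by (rule eventually_at_left_real) simp
  ultimately show "\<forall>\<^sub>F r in at_left 1.
      dist (alexiewicz_norm (\<lambda>\<theta>. poisson_integral f r \<theta> - f \<theta>)) 0 < e"
  proof eventually_elim
    case (elim r)
    then have r: "0 \<le> r" "r < 1" by auto
    have "alexiewicz_norm (\<lambda>\<theta>. poisson_integral f r \<theta> - f \<theta>)
        \<le> 2 * (e / 4) + 4 * pi * alexiewicz_norm f * poisson_kernel r \<delta>"
      by (rule alexiewicz_norm_poisson_diff_le[OF f r \<delta>(1)])
        (use d(2) in \<open>auto simp: \<delta>_def intro: less_imp_le\<close>)
    moreover have "0 \<le> alexiewicz_norm (\<lambda>\<theta>. poisson_integral f r \<theta> - f \<theta>)"
      by (intro alexiewicz_norm_nonneg HK_diff poisson_integral_in_HK f r)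
    ultimately show ?case
      using elim(1) by simp
  qed
qed

subsection \<open>Arbitrarily slow decay\<close>

text \<open>Reduction by the floor maps \<open>pi\<close> to \<open>- pi\<close>, so agreement on
  the closed interval requires equal endpoint values.\<close>

lemma periodic_extension:
  assumes "g integrable_on {-pi..pi}" "g (- pi) = g pi"
  obtains f where "f \<in> HK" "\<And>x. x \<in> {-pi..pi} \<Longrightarrow> f x = g x"
proof -
  define f where "f x = g (x - 2 * pi * of_int \<lfloor>(x + pi) / (2 * pi)\<rfloor>)" for x
  have eq: "f x = g x" if "x \<in> {-pi..pi}" for x
  proof (cases "x = pi")
    case True
    then show ?thesis using assms(2) by (simp add: f_def)
  next
    case False
    then have "\<lfloor>(x + pi) / (2 * pi)\<rfloor> = 0"
      using that by (simp add: floor_eq_iff field_simps)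
    then show ?thesis by (simp add: f_def)
  qed
  have "f (x + 2 * pi) = f x" for x
  proof -
    have "(x + 2 * pi + pi) / (2 * pi) = (x + pi) / (2 * pi) + 1"
      by (simp add: field_simps)
    then show ?thesis by (simp add: f_def algebra_simps)
  qed
  moreover have "f integrable_on {-pi..pi}"
    using assms(1) eq by (metis integrable_cong)
  ultimately show thesis
    using eq by (intro that[of f]) (auto simp: HK_def)
qed

text \<open>The function is a sum of rectangles over \<open>{0<..<d k}\<close> with area
  \<open>(1/2) ^ k\<close>. The areas sum to 2, so monotone convergence makes the sum integrable,
  and by nonnegativity it dominates each rectangle.\<close>

lemma exists_superposition:
  fixes d :: "nat \<Rightarrow> real"
  assumes d: "\<And>k. 0 < d k" "\<And>k. d k \<le> (1/2) ^ Suc k"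
  obtains f where "f \<in> HK" "\<And>x. x \<in> {-pi..pi} \<Longrightarrow> 0 \<le> f x" "integral {-pi..pi} f \<le> 2"
    "\<And>k. (1/2) ^ k \<le> integral {0..d k} f"
proof -
  define h where "h k x = (if x \<in> {0<..<d k} then (1/2) ^ k / d k else 0)" for k x
  define F where "F n x = (\<Sum>k<n. h k x)" for n x
  define g where "g x = (\<Sum>k. h k x)" for x
  have d_le_1: "d k \<le> 1" for k
    using d(2)[of k] power_le_one[of "1/2 :: real" "Suc k"] by linarith
  have h_nonneg: "0 \<le> h k x" for k x
    using d(1)[of k] by (simp add: h_def)
  have h_int: "(h k has_integral (1/2) ^ k) S" if "{0<..<d k} \<subseteq> S" for k S
  proof -
    have "((\<lambda>x. (1/2) ^ k / d k) has_integral (1/2) ^ k) {0..d k}"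
      using has_integral_const_real[of "(1/2) ^ k / d k" 0 "d k"] d(1)[of k] by simp
    then show ?thesis
      unfolding h_def has_integral_restrict[OF that] by (simp only: has_integral_Icc_iff_Ioo)
  qed
  have sub: "{0<..<d k} \<subseteq> {-pi..pi}" for k
    using d_le_1[of k] pi_gt3 by auto
  have F_int: "(F n has_integral (\<Sum>k<n. (1/2) ^ k)) {-pi..pi}" for n
    unfolding F_def by (intro has_integral_sum h_int sub) auto
  have sum_le: "(\<Sum>k<n. (1/2 :: real) ^ k) \<le> 2" for n
    by (simp add: sum_gp_strict)
  \<comment> \<open>The rectangles leave out 0, so at \<open>x \<le> 0\<close> every term vanishes;
    at \<open>x > 0\<close> only finitely many survive because \<open>d k\<close> tends to 0. The
    series thus converges at every point.\<close>
  have summable: "summable (\<lambda>k. h k x)" for x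
  proof (cases "x > 0")
    case True
    then obtain N where N: "(1/2) ^ N < x"
      using real_arch_pow_inv[of x "1/2"] by auto
    have "h k x = 0" if "k \<notin> {..<N}" for k
    proof -
      have "(1/2 :: real) ^ Suc k \<le> (1/2) ^ N"
        using that by (intro power_decreasing) auto
      then show ?thesis using N d(2)[of k] by (simp add: h_def)
    qed
    then show ?thesis by (intro summable_finite[of "{..<N}"]) auto
  qed (simp add: h_def)
  have F_lim: "(\<lambda>n. F n x) \<longlonglongrightarrow> g x" for x
    unfolding F_def g_def by (rule summable_LIMSEQ[OF summable])
  have "g integrable_on {-pi..pi} \<and> (\<lambda>n. integral {-pi..pi} (F n)) \<longlonglongrightarrow> integral {-pi..pi} g"
  proof (rule monotone_convergence_increasing)
    show "F n integrable_on {-pi..pi}" for n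
      using F_int by blast
    show "F n x \<le> F (Suc n) x" for n x
      by (simp add: F_def h_nonneg)
    show "bounded (range (\<lambda>n. integral {-pi..pi} (F n)))"
      using F_int sum_le
      by (auto simp: bounded_iff has_integral_integrable_integral sum_nonneg intro!: exI[of _ 2])
  qed (rule F_lim)
  then have g_int: "g integrable_on {-pi..pi}"
    and g_lim: "(\<lambda>n. integral {-pi..pi} (F n)) \<longlonglongrightarrow> integral {-pi..pi} g" by auto
  have g_le: "integral {-pi..pi} g \<le> 2"
    using g_lim F_int sum_le by (intro LIMSEQ_le_const2[OF g_lim]) (auto simp: has_integral_integrable_integral)
  have g_nonneg: "0 \<le> g x" for x
    unfolding g_def by (intro suminf_nonneg summable h_nonneg)
  have h_le_g: "h k x \<le> g x" for k x
    unfolding g_def using sum_le_suminf[OF summable, of "{k}" x] h_nonneg by simp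
  \<comment> \<open>All rectangles stand over subsets of \<open>{0<..<1}\<close>, which gives the
    matching endpoint values needed for the periodic extension.\<close>
  have "h k pi = 0" "h k (- pi) = 0" for k
    using d_le_1[of k] pi_gt3 by (auto simp: h_def)
  then have "g (- pi) = g pi"
    by (simp add: g_def)
  with g_int obtain f where f: "f \<in> HK" and fg: "\<And>x. x \<in> {-pi..pi} \<Longrightarrow> f x = g x"
    using periodic_extension by blast
  have "integral {-pi..pi} f \<le> 2"
    using g_le fg by (metis (no_types, lifting) integral_cong)
  moreover have "(1/2) ^ k \<le> integral {0..d k} f" for k
  proof -
    have "(h k has_integral (1/2) ^ k) {0..d k}"
      by (rule h_int) auto
    moreover have "f integrable_on {0..d k}"
      by (rule locally_integrableD[OF HK_locally_integrable[OF f]])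
    moreover have "h k x \<le> f x" if "x \<in> {0..d k}" for x
      using h_le_g[of k x] fg[of x] that d_le_1[of k] pi_gt3 by auto
    ultimately show ?thesis
      by (metis has_integral_integrable_integral integral_le)
  qed
  ultimately show thesis
    using f fg g_nonneg by (intro that[of f]) auto
qed

lemma poisson_integral_le:
  assumes f: "f \<in> HK" and nonneg: "\<And>x. x \<in> {-pi..pi} \<Longrightarrow> 0 \<le> f x" and r: "0 \<le> r" "r < 1"
  shows "poisson_integral f r \<theta> \<le> integral {-pi..pi} f / (pi * (1 - r))"
proof -
  have "poisson_integral f r \<theta> \<le> integral {-pi..pi} (\<lambda>\<phi>. f \<phi> * (1 / (pi * (1 - r))))"
    unfolding poisson_integral_def
    using f by (intro integral_le poisson_product_integrable f r integrable_on_mult_left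
        mult_left_mono poisson_kernel_le_peak nonneg) (auto simp: HK_def)
  then show ?thesis by (simp add: Henstock_Kurzweil_Integration.integral_mult_left)
qed

text \<open>Each \<open>r\<close> is tested on a single interval \<open>{0..d k}\<close>, with
  \<open>k\<close> chosen so that \<open>(1/2) ^ (k + 2) < A r \<le> (1/2) ^ Suc k\<close>. There
  \<open>f\<close> has mass at least \<open>(1/2) ^ k\<close> and its Poisson integral at most half
  of that, so the gap is at least \<open>(1/2) ^ Suc k\<close>.\<close>

lemma arbitrarily_slow_decay:
  fixes A :: "real \<Rightarrow> real"
  assumes A: "A \<in> {0..<1} \<rightarrow> {0<..<1/2}" and antimono: "antimono_on {0..<1} A"
    and lim: "(A \<longlongrightarrow> 0) (at_left 1)"
  shows "\<exists>f\<in>HK. \<forall>r\<in>{0..<1}. alexiewicz_norm (\<lambda>\<theta>. poisson_integral f r \<theta> - f \<theta>) \<ge> A r"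
proof -
  have "\<exists>s\<in>{0..<1}. A s \<le> (1/2) ^ (k + 2)" for k
  proof -
    have "\<forall>\<^sub>F r in at_left 1. A r < (1/2) ^ (k + 2)"
      by (rule order_tendstoD[OF lim]) simp
    moreover have "\<forall>\<^sub>F r in at_left (1::real). r \<in> {0<..<1}"
      by (rule eventually_at_left_real) simp
    ultimately have "\<forall>\<^sub>F r in at_left 1. A r < (1/2) ^ (k + 2) \<and> r \<in> {0<..<1}"
      by (rule eventually_conj)
    then obtain r where "A r < (1/2) ^ (k + 2)" "r \<in> {0<..<1}"
      using eventually_happens'[OF trivial_limit_at_left_real] by blast
    then show ?thesis by (intro bexI[of _ r]) auto
  qed
  then obtain s where s: "\<And>k. s k \<in> {0..<1}" and As: "\<And>k. A (s k) \<le> (1/2) ^ (k + 2)"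
    by metis
  \<comment> \<open>For \<open>r < s k\<close>, a function bounded by \<open>1 / (1 - r)\<close> has
    integral at most \<open>(1/2) ^ Suc k\<close> over an interval of this length.\<close>
  define d where "d k = (1/2) ^ Suc k * (1 - s k)" for k
  have d_pos: "0 < d k" and d_le: "d k \<le> (1/2) ^ Suc k" for k
    using s[of k] by (auto simp: d_def intro: mult_left_le)
  then obtain f where f: "f \<in> HK" and nonneg: "\<And>x. x \<in> {-pi..pi} \<Longrightarrow> 0 \<le> f x"
    and total: "integral {-pi..pi} f \<le> 2" and mass: "\<And>k. (1/2) ^ k \<le> integral {0..d k} f"
    using exists_superposition by blast
  have "A r \<le> alexiewicz_norm (\<lambda>\<theta>. poisson_integral f r \<theta> - f \<theta>)" if "r \<in> {0..<1}" for r
  proof -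
    have r: "0 \<le> r" "r < 1" and Ar: "0 < A r" "A r < 1/2"
      using that A by auto
    obtain n where "(1/2) ^ n < A r"
      using real_arch_pow_inv[OF Ar(1), of "1/2"] by auto
    moreover have "(1/2 :: real) ^ (n + 2) \<le> (1/2) ^ n"
      by (intro power_decreasing) auto
    ultimately have ex: "\<exists>k. (1/2) ^ (k + 2) < A r"
      by (intro exI[of _ n]) linarith
    define k where "k = (LEAST k. (1/2) ^ (k + 2) < A r)"
    have k_less: "(1/2) ^ (k + 2) < A r"
      unfolding k_def by (rule LeastI_ex[OF ex])
    have k_ge: "A r \<le> (1/2) ^ Suc k"
    \<comment> \<open>For the least index 0 no predecessor gives the upper bound; there it is the
      assumption that \<open>A\<close> stays below 1/2.\<close>
    proof (cases k)
      case 0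
      then show ?thesis using Ar by simp
    next
      case (Suc m)
      then have "\<not> (1/2) ^ (m + 2) < A r"
        using not_less_Least[of m "\<lambda>k. (1/2) ^ (k + 2) < A r"] unfolding k_def by simp
      then show ?thesis using Suc by simp
    qed
    \<comment> \<open>Otherwise monotonicity would give
      \<open>A r \<le> A (s k) \<le> (1/2) ^ (k + 2)\<close>, against the choice of
      \<open>k\<close>.\<close>
    have "r < s k"
    proof (rule ccontr)
      assume "\<not> r < s k"
      then have "A r \<le> A (s k)"
        using antimono s[of k] that by (auto simp: monotone_on_def)
      then show False using As[of k] k_less by linarith
    qed
    define u where "u = poisson_integral f r"
    have u: "u \<in> HK" unfolding u_def by (rule poisson_integral_in_HK[OF f r])
    have "u \<theta> \<le> 1 / (1 - r)" for \<theta>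
    proof -
      have "u \<theta> \<le> integral {-pi..pi} f / (pi * (1 - r))"
        unfolding u_def by (rule poisson_integral_le[OF f nonneg r])
      \<comment> \<open>The total mass 2 is below \<open>pi\<close>, which cancels the
        \<open>pi\<close> from the peak of the kernel.\<close>
      also have "\<dots> \<le> pi / (pi * (1 - r))"
        using total pi_ge_two r by (intro divide_right_mono) auto
      finally show ?thesis by simp
    qed
    then have "integral {0..d k} u \<le> integral {0..d k} (\<lambda>_. 1 / (1 - r))"
      by (intro integral_le locally_integrableD[OF HK_locally_integrable[OF u]] integrable_const_ivl)
    also have "\<dots> = (1/2) ^ Suc k * ((1 - s k) / (1 - r))"
      using d_pos[of k] by (simp add: d_def)
    also have "\<dots> \<le> (1/2) ^ Suc k * 1"
      using \<open>r < s k\<close> r by (intro mult_left_mono) auto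
    finally have "integral {0..d k} u \<le> (1/2) ^ Suc k" by simp
    moreover have "integral {0..d k} (\<lambda>\<theta>. u \<theta> - f \<theta>) = integral {0..d k} u - integral {0..d k} f"
      by (intro Henstock_Kurzweil_Integration.integral_diff locally_integrableD HK_locally_integrable u f)
    moreover have "\<bar>integral {0..d k} (\<lambda>\<theta>. u \<theta> - f \<theta>)\<bar> \<le> alexiewicz_norm (\<lambda>\<theta>. u \<theta> - f \<theta>)"
    proof (rule integral_le_alexiewicz_norm[OF HK_diff[OF u f]])
      have "(1/2 :: real) ^ Suc k \<le> 1" by (rule power_le_one) auto
      then show "d k - 0 \<le> 2 * pi" using d_le[of k] pi_gt3 by linarith
    qed (use d_pos[of k] in simp)
    ultimately show ?thesis
      using mass[of k] k_ge unfolding u_def by simp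
  qed
  with f show ?thesis by blast
qed

theorem theorem6:
  "(\<forall>f\<in>HK.
      (\<forall>r\<in>{0..<1}. alexiewicz_norm (poisson_integral f r) \<le> alexiewicz_norm f) \<and>
      (SUP r\<in>{0..<1}. alexiewicz_norm (poisson_integral f r)) \<le> alexiewicz_norm f \<and>
      ((\<lambda>r. alexiewicz_norm (\<lambda>\<theta>. poisson_integral f r \<theta> - f \<theta>)) \<longlongrightarrow> 0) (at_left 1)) \<and>
   (\<forall>A :: real \<Rightarrow> real.
      A \<in> {0..<1} \<rightarrow> {0<..<1/2} \<longrightarrow> antimono_on {0..<1} A \<longrightarrow> (A \<longlongrightarrow> 0) (at_left 1) \<longrightarrow>
      (\<exists>f\<in>HK. \<forall>r\<in>{0..<1}. alexiewicz_norm (\<lambda>\<theta>. poisson_integral f r \<theta> - f \<theta>) \<ge> A r))"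
proof (intro conjI ballI allI impI)
  fix f assume f: "f \<in> HK"
  show le: "alexiewicz_norm (poisson_integral f r) \<le> alexiewicz_norm f" if "r \<in> {0..<1}" for r
    using alexiewicz_norm_poisson_integral_le[OF f] that by simp
  show "(SUP r\<in>{0..<1}. alexiewicz_norm (poisson_integral f r)) \<le> alexiewicz_norm f"
    by (rule cSUP_least) (use le in auto)
qed (simp_all add: poisson_integral_tendsto arbitrarily_slow_decay)

end
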